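(* For all nonnegative integers $m,n$ with $n\ge m\ge 0$, $$\binom{n}{m}=\sum_{l=0}^{n-m}\frac{\binom{l+m}{l}}{\binom{l+n+1}{l}}\,S_2(l+n+1,n+1)\,S_1(n,l+m).$$
   Context: $S_1(n,l)$ denotes the (signed) Stirling numbers of the first kind, defined by $(x)_n=\sum_{l=0}^{n}S_1(n,l)x^l$, where $(x)_n=x(x-1)\cdots(x-n+1)$ is the falling factorial, $(x)_0=1$. $S_2(n,k)$ denotes the Stirling numbers of the second kind, i.e. $(e^t-1)^k=k!\sum_{n\ge k}S_2(n,k)\frac{t^n}{n!}$. *)

theory Defs
  imports
    Complex_Main
    "HOL-Combinatorics.Stirling"
    "HOL-Computational_Algebra.Polynomial"
    "HOL-Computational_Algebra.Formal_Power_Series"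
begin

(* The library's stirling is the unsigned version. *)
definition S1 :: "nat \<Rightarrow> nat \<Rightarrow> int"
  where "S1 n l = coeff (\<Prod>i<n. [:- int i, 1:]) l"

lemma S1_falling_factorial:
  fixes x :: real
  shows "(\<Prod>i<n. x - real i) = (\<Sum>l=0..n. real_of_int (S1 n l) * x ^ l)"
proof -
  let ?p = "\<Prod>i<n. [:- int i, 1:]"
  have deg: "degree ?p \<le> n"
    using degree_prod_sum_le[of "{..<n}" "\<lambda>i. [:- int i, 1:]"] by simp
  have map: "map_poly real_of_int ?p = (\<Prod>i<n. [:- real i, 1:])"
  proof (induction n)
    case (Suc n)
    have "map_poly real_of_int (p * [:- int i, 1:])
        = map_poly real_of_int p * [:- real i, 1:]" for p i
      by (rule poly_eqI) (simp add: coeff_map_poly coeff_pCons split: nat.split)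
    then show ?case using Suc by simp
  qed simp
  have le: "degree (map_poly real_of_int ?p) \<le> n"
    using deg by (intro degree_le) (simp add: coeff_map_poly coeff_eq_0)
  have "(\<Prod>i<n. x - real i) = poly (map_poly real_of_int ?p) x"
    unfolding map by (simp add: poly_prod)
  also have "\<dots> = (\<Sum>l\<le>n. coeff (map_poly real_of_int ?p) l * x ^ l)"
    unfolding poly_altdef using le
    by (intro sum.mono_neutral_left)
       (auto simp: coeff_eq_0)
  finally show ?thesis
    by (simp add: S1_def coeff_map_poly atMost_atLeast0)
qed

(* The library defines Stirling by recursion. *)
lemma Stirling_egf:
  includes fps_syntax
  shows "(fps_exp 1 - 1) ^ k = fps_const (fact k) * Abs_fps (\<lambda>n. real (Stirling n k) / fact n)"
proof (induction k)
  case 0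
  have "real (Stirling n 0) / fact n = (if n = 0 then 1 else 0)" for n
    by (cases n) auto
  then show ?case by (simp add: fps_eq_iff)
next
  case (Suc k)
  let ?E = "fps_exp 1 - 1 :: real fps"
  let ?F = "\<lambda>k. Abs_fps (\<lambda>n. real (Stirling n k) / fact n)"
  have rec: "fps_deriv (?F (Suc k)) = ?F k + of_nat (Suc k) * ?F (Suc k)"
  proof (rule fps_ext)
    fix n
    have "fps_deriv (?F (Suc k)) $ n = real (Stirling (Suc n) (Suc k)) / fact n"
      by (simp add: fact_Suc del: of_nat_Suc Stirling.simps)
    also have "\<dots> = (?F k + of_nat (Suc k) * ?F (Suc k)) $ n"
      by (simp add: fps_mult_of_nat_nth add_divide_distrib ring_distribs)
    finally show "fps_deriv (?F (Suc k)) $ n = (?F k + of_nat (Suc k) * ?F (Suc k)) $ n" .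
  qed
  define D where "D = ?E ^ Suc k - fps_const (fact (Suc k)) * ?F (Suc k)"
  have E': "fps_deriv (?E ^ Suc k) = of_nat (Suc k) * (?E ^ k + ?E ^ Suc k)"
  proof -
    have "fps_deriv (?E ^ Suc k) = of_nat (Suc k) * fps_exp 1 * ?E ^ k"
      by (simp add: fps_deriv_power' del: power_Suc of_nat_Suc)
    also have "\<dots> = of_nat (Suc k) * (?E ^ k + ?E ^ Suc k)"
      by (simp add: algebra_simps)
    finally show ?thesis .
  qed
  have c: "fps_const (fact (Suc k)) = of_nat (Suc k) * (fps_const (fact k) :: real fps)"
    by (simp only: fps_of_nat[symmetric] fps_const_mult fact_Suc)
  have "fps_deriv D = of_nat (Suc k) * D"
    unfolding D_def fps_deriv_sub E' fps_deriv_mult_const_left rec Suc.IH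
    unfolding c by (simp add: algebra_simps del: of_nat_Suc)
  then have "fps_deriv D = fps_const (real (Suc k)) * D"
    by (simp only: fps_of_nat)
  then have "D = fps_const (D $ 0) * fps_exp (real (Suc k))"
    by (simp only: fps_exp_unique_ODE)
  moreover have "D $ 0 = 0" by (simp add: D_def)
  ultimately have "D = 0" by simp
  then show ?case by (simp add: D_def)
qed

end

theory Submission
  imports Defs "HOL-Computational_Algebra.Formal_Laurent_Series"
begin

text \<open>
  The functional sending a power series \<open>f\<close> to \<open>\<Sum>j. S1 n j * j! * f\<^sub>j\<close> is \<open>(D)\<^sub>n f\<close> evaluated at
  \<open>0\<close>, where \<open>(D)\<^sub>n = D (D - 1) \<cdots> (D - n + 1)\<close> and \<open>D = d/dt\<close>. Integration by parts for residues
  shows that it equals \<open>n!\<close> times the residue of \<open>f e\<^sup>t / (e\<^sup>t - 1)\<^sup>n\<^sup>+\<^sup>1\<close>. Up to the factor \<open>1 / m!\<close>, the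
  right-hand side of the theorem is its value at \<open>f = t\<^sup>m ((e\<^sup>t - 1) / t)\<^sup>n\<^sup>+\<^sup>1\<close>, where the residue
  is that of \<open>t\<^sup>m e\<^sup>t / t\<^sup>n\<^sup>+\<^sup>1\<close>, namely \<open>1 / (n - m)!\<close>.
\<close>

lemma S1_0: "S1 0 l = (if l = 0 then 1 else 0)"
  by (simp add: S1_def)

lemma S1_Suc: "S1 (Suc n) l = (if l = 0 then 0 else S1 n (l - 1)) - int n * S1 n l"
  by (cases l) (simp_all add: S1_def coeff_pCons algebra_simps)

lemma S1_eq_0:
  assumes "n < l"
  shows "S1 n l = 0"
proof -
  have "degree (\<Prod>i<n. [:- int i, 1:]) \<le> n"
    using degree_prod_sum_le[of "{..<n}" "\<lambda>i. [:- int i, 1:]"] by simp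
  then show ?thesis
    using assms by (simp add: S1_def coeff_eq_0)
qed

definition fps_falling_deriv0 :: "nat \<Rightarrow> 'a::field_char_0 fps \<Rightarrow> 'a" where
  "fps_falling_deriv0 n f = (\<Sum>j\<le>n. of_int (S1 n j) * fact j * fps_nth f j)"

lemma fps_falling_deriv0_0: "fps_falling_deriv0 0 f = fps_nth f 0"
  by (simp add: fps_falling_deriv0_def S1_0)

text \<open>This is \<open>(D)_(n+1) = (D)_n (D - n)\<close>: the shifted part of the recursion for
  \<open>S1\<close> produces the coefficients of \<open>fps_deriv f\<close>.\<close>

lemma fps_falling_deriv0_Suc:
  "fps_falling_deriv0 (Suc n) f
    = fps_falling_deriv0 n (fps_deriv f) - of_nat n * fps_falling_deriv0 n f"
proof -
  have "fps_falling_deriv0 (Suc n) f =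
      (\<Sum>j\<le>Suc n. (if j = 0 then 0 else of_int (S1 n (j - 1)) * fact j * fps_nth f j))
      - of_nat n * (\<Sum>j\<le>Suc n. of_int (S1 n j) * fact j * fps_nth f j)"
    unfolding fps_falling_deriv0_def sum_distrib_left sum_subtractf[symmetric]
    by (intro sum.cong) (auto simp: S1_Suc algebra_simps)
  also have "(\<Sum>j\<le>Suc n. (if j = 0 then 0 else of_int (S1 n (j - 1)) * fact j * fps_nth f j))
      = fps_falling_deriv0 n (fps_deriv f)"
    unfolding fps_falling_deriv0_def
    by (subst sum.atMost_Suc_shift) (simp add: algebra_simps)
  also have "(\<Sum>j\<le>Suc n. of_int (S1 n j) * fact j * fps_nth f j) = fps_falling_deriv0 n f"
    by (simp add: fps_falling_deriv0_def S1_eq_0)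
  finally show ?thesis .
qed

text \<open>Division by \<open>t^(n+1)\<close> lowers degrees by \<open>n + 1\<close>, so the
  coefficient of degree \<open>n\<close> becomes the residue.\<close>

lemma fls_X_power_div_nth:
  fixes h :: "'a::field fps"
  shows "fls_nth (fps_to_fls h / fls_X ^ Suc n) (-1) = fps_nth h n"
proof -
  have "fps_to_fls h / fls_X ^ Suc n = fls_X_inv ^ Suc n * fps_to_fls h"
    by (simp add: divide_inverse fls_inverse_X_power mult.commute del: power_Suc)
  also have "\<dots> = fls_shift (int (Suc n)) (fps_to_fls h)"
    by (rule fls_X_inv_power_times_conv_shift)
  finally show ?thesis by simp
qed

text \<open>The series \<open>(e^t - 1) / t\<close>, a unit because its constant term is 1.\<close>

definition fps_exp_quotient :: "'a::field_char_0 fps" where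
  "fps_exp_quotient = Abs_fps (\<lambda>n. 1 / fact (Suc n))"

lemma fps_exp_minus_1: "fps_exp 1 - 1 = fps_X * (fps_exp_quotient :: 'a::field_char_0 fps)"
  by (rule fps_ext) (auto simp: fps_exp_quotient_def fact_reduce)

lemma fps_exp_quotient_nth_0 [simp]: "fps_nth fps_exp_quotient 0 = 1"
  by (simp add: fps_exp_quotient_def)

lemma fps_exp_quotient_nonzero [simp]: "fps_exp_quotient \<noteq> 0"
  by (metis fps_exp_quotient_nth_0 fps_zero_nth zero_neq_one)

text \<open>Cancelling the unit turns a pole in \<open>e^t - 1\<close> into one in \<open>t\<close>,
  where the residue is a plain coefficient.\<close>

lemma fps_exp_quotient_power_div:
  fixes g :: "'a::field_char_0 fps"
  shows "fps_to_fls (fps_exp_quotient ^ k * g) / fps_to_fls (fps_exp 1 - 1) ^ k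
    = fps_to_fls g / fls_X ^ k"
  unfolding fps_exp_minus_1
  by (simp add: fls_times_fps_to_fls fps_to_fls_power power_mult_distrib)

text \<open>Both sides satisfy the same recursion in \<open>n\<close>. It involves
  \<open>fps_deriv f\<close>, hence the induction over all \<open>f\<close>.\<close>

theorem fps_falling_deriv0_conv_residue:
  fixes f :: "'a::field_char_0 fps"
  shows "fps_falling_deriv0 n f
    = fact n * fls_residue (fps_to_fls (f * fps_exp 1) / fps_to_fls (fps_exp 1 - 1) ^ Suc n)"
proof (induction n arbitrary: f)
  case 0
  let ?Q = "fps_exp_quotient :: 'a fps"
  \<comment> \<open>The pole is simple, so the residue is the constant term of
    \<open>f e^t / ?Q\<close>, which is that of \<open>f\<close>.\<close>
  have "?Q ^ Suc 0 * (f * fps_exp 1 * inverse ?Q) = f * fps_exp 1"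
    using inverse_mult_eq_1'[of ?Q] by (simp add: mult.left_commute)
  then have "fps_to_fls (f * fps_exp 1) / fps_to_fls (fps_exp 1 - 1) ^ Suc 0
      = fps_to_fls (f * fps_exp 1 * inverse ?Q) / fls_X ^ Suc 0"
    by (metis fps_exp_quotient_power_div)
  then show ?case
    using fls_X_power_div_nth[of "f * fps_exp 1 * inverse ?Q" 0]
    by (simp add: fps_falling_deriv0_0 del: fps_to_fls_minus)
next
  case (Suc n)
  define e where "e = fps_to_fls (fps_exp (1::'a))"
  define F where "F = fps_to_fls f"
  define h where "h k = e / (e - 1) ^ Suc k" for k
  have e1: "e - 1 \<noteq> 0"
    using fps_exp_minus_1[where 'a = 'a] fps_exp_quotient_nonzero[where 'a = 'a]
    by (simp add: e_def flip: fps_to_fls_minus fps_one_to_fls del: fps_to_fls_eq_iff)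
  have e': "fls_deriv e = e"
    by (simp add: e_def fls_deriv_fps_to_fls)
  have h: "fps_to_fls (g * fps_exp 1) / fps_to_fls (fps_exp 1 - 1) ^ Suc k = fps_to_fls g * h k"
    for g :: "'a fps" and k
    by (simp add: h_def e_def fls_times_fps_to_fls)
  have h': "fls_deriv (h n) = - of_nat n * h n - of_nat (Suc n) * h (Suc n)"
  proof -
    \<comment> \<open>The quotient is differentiated implicitly, by the product rule on
      \<open>h n * (e - 1)^(n+1) = e\<close>; writing \<open>e = (e - 1) + 1\<close> leads back to
      \<open>h n\<close> and \<open>h (Suc n)\<close>.\<close>
    have h_n: "h n * (e - 1) ^ Suc n = e"
      using e1 by (simp add: h_def)
    have h_Suc: "h (Suc n) * (e - 1) ^ Suc n = h n * (e - 1) ^ n"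
      using e1 by (simp add: h_def)
    have e_pow: "(e - 1) ^ n * e = (e - 1) ^ Suc n + (e - 1) ^ n"
      by (simp add: left_diff_distrib mult.commute)
    have "e = fls_deriv (h n * (e - 1) ^ Suc n)"
      unfolding h_n e' ..
    also have "\<dots> = of_nat (Suc n) * (h n * ((e - 1) ^ n * e))
        + fls_deriv (h n) * (e - 1) ^ Suc n"
      using e' by (simp only: fls_deriv_mult fls_deriv_power) simp
    also have "h n * ((e - 1) ^ n * e) = e + h n * (e - 1) ^ n"
      unfolding e_pow distrib_left h_n ..
    finally have "fls_deriv (h n) * (e - 1) ^ Suc n
        = e - of_nat (Suc n) * (e + h n * (e - 1) ^ n)"
      by (metis add_diff_cancel_left')
    also have "\<dots> = - of_nat n * (h n * (e - 1) ^ Suc n)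
        - of_nat (Suc n) * (h (Suc n) * (e - 1) ^ Suc n)"
      unfolding h_n h_Suc by (simp add: algebra_simps)
    also have "\<dots> = (- of_nat n * h n - of_nat (Suc n) * h (Suc n)) * (e - 1) ^ Suc n"
      by (simp only: left_diff_distrib mult.assoc)
    finally show ?thesis using e1 by simp
  qed
  \<comment> \<open>Derivatives have residue 0, so the derivative moves from \<open>F\<close> to
    \<open>h n\<close>. The resulting \<open>n * h n\<close> term cancels the subtraction in the
    recursion, and the factor \<open>n + 1\<close> completes \<open>fact n\<close> to
    \<open>fact (Suc n)\<close>.\<close>
  have "fls_residue (fls_deriv F * h n) = - fls_residue (F * fls_deriv (h n))"
    by (rule fls_residue_times_deriv)
  also have "F * fls_deriv (h n)
      = - (fls_const (of_nat n) * (F * h n) + fls_const (of_nat (Suc n)) * (F * h (Suc n)))"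
    unfolding h' fls_of_nat by (simp add: algebra_simps)
  finally have "fls_residue (fls_deriv F * h n)
      = of_nat n * fls_residue (F * h n) + of_nat (Suc n) * fls_residue (F * h (Suc n))"
    by simp
  then show ?case
    unfolding fps_falling_deriv0_Suc Suc.IH h fls_deriv_fps_to_fls[symmetric] F_def
    by (simp add: algebra_simps)
qed

lemma fps_exp_minus_1_power_nth:
  "fps_nth ((fps_exp 1 - 1) ^ k) i = fact k * real (Stirling i k) / fact i"
  by (simp add: Stirling_egf)

text \<open>Since \<open>(e^t - 1)^k = t^k Q^k\<close> for this quotient \<open>Q\<close>, its index
  is shifted by \<open>k\<close>.\<close>

lemma fps_exp_quotient_power_nth:
  "fps_nth (fps_exp_quotient ^ k) l = fact k * real (Stirling (l + k) k) / fact (l + k)"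
  using fps_exp_minus_1_power_nth[of k "l + k"]
  by (simp add: fps_exp_minus_1 power_mult_distrib fps_X_power_mult_nth)

theorem theorem1:
  fixes m n :: nat
  assumes "m \<le> n"
  shows "real (n choose m) =
    (\<Sum>l=0..n-m. real ((l + m) choose l) / real ((l + n + 1) choose l)
        * real (Stirling (l + n + 1) (n + 1)) * real_of_int (S1 n (l + m)))"
proof -
  let ?Q = "fps_exp_quotient :: real fps"
  let ?f = "fps_X ^ m * ?Q ^ Suc n"
  have summand: "real ((l + m) choose l) / real ((l + n + 1) choose l)
        * real (Stirling (l + n + 1) (n + 1)) * real_of_int (S1 n (l + m))
      = real_of_int (S1 n (l + m)) * fact (l + m) * fps_nth ?f (l + m) / fact m" for l
  proof -
    \<comment> \<open>In the ratio of the binomials \<open>fact l\<close> cancels, leaving the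
      factorials that \<open>S1\<close> and the coefficient of \<open>?f\<close> require.\<close>
    have 1: "real ((l + m) choose l) = fact (l + m) / (fact l * fact m)"
      using binomial_fact[of l "l + m", where 'a = real] by simp
    have 2: "real ((l + n + 1) choose l) = fact (l + n + 1) / (fact l * fact (n + 1))"
      using binomial_fact[of l "l + n + 1", where 'a = real] by simp
    have 3: "fps_nth ?f (l + m)
        = fact (n + 1) * real (Stirling (l + n + 1) (n + 1)) / fact (l + n + 1)"
      using fps_exp_quotient_power_nth[of "Suc n" l]
      by (simp add: fps_X_power_mult_nth del: power_Suc Stirling.simps fact_Suc)
    show ?thesis
      unfolding 1 2 3 by (simp add: field_simps del: fact_Suc Stirling.simps)
  qed
  have "(\<Sum>l=0..n-m. real ((l + m) choose l) / real ((l + n + 1) choose l)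
        * real (Stirling (l + n + 1) (n + 1)) * real_of_int (S1 n (l + m)))
      = (\<Sum>l=0..n-m. real_of_int (S1 n (l + m)) * fact (l + m) * fps_nth ?f (l + m) / fact m)"
    using summand by (intro sum.cong) auto
  also have "\<dots> = (\<Sum>j=m..n. real_of_int (S1 n j) * fact j * fps_nth ?f j / fact m)"
    using assms
      sum.shift_bounds_cl_nat_ivl[of
        "\<lambda>j. real_of_int (S1 n j) * fact j * fps_nth ?f j / fact m" 0 m "n - m"]
    by simp
  \<comment> \<open>The terms with \<open>j < m\<close> vanish because \<open>?f\<close> is
    divisible by \<open>t^m\<close>.\<close>
  also have "\<dots> = fps_falling_deriv0 n ?f / fact m"
    unfolding fps_falling_deriv0_def sum_divide_distrib
    by (intro sum.mono_neutral_left) (auto simp: fps_X_power_mult_nth)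
  also have "fps_falling_deriv0 n ?f
      = fact n * fls_residue (fps_to_fls (fps_X ^ m * fps_exp 1) / fls_X ^ Suc n)"
    using fps_exp_quotient_power_div[of "Suc n" "fps_X ^ m * fps_exp (1::real)"]
    by (simp only: fps_falling_deriv0_conv_residue mult_ac)
  \<comment> \<open>The residue is the coefficient of \<open>t^(n-m)\<close> in
    \<open>e^t\<close>.\<close>
  also have "\<dots> = fact n / fact (n - m)"
    using assms unfolding fls_residue_def fls_X_power_div_nth
    by (simp add: fps_X_power_mult_nth)
  also have "\<dots> / fact m = real (n choose m)"
    using binomial_fact[OF assms, where 'a = real] by (simp add: field_simps)
  finally show ?thesis by simp
qed

end
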